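(* Let $(X,d)$ be an ultrametric space. Then $(X,d)$ is discrete if and only if $(\bar{\mathbf{B}}_X, d_H)$ is discrete.
   Context: Metric spaces are nonempty. An ultrametric space is a metric space $(X,d)$ with $d(x,y)\le\max\{d(x,z),d(z,y)\}$ for all $x,y,z\in X$. For $c\in X$ and $r\ge 0$ the closed ball is $\bar B_r(c)=\{x\in X: d(c,x)\le r\}$ (so $\bar B_0(c)=\{c\}$). $\bar{\mathbf{B}}_X$ is the set of all closed balls $\bar B_r(c)$, $c\in X$, $r\ge 0$, regarded as subsets of $X$. The Hausdorff distance between nonempty closed bounded sets $A,B\subseteq X$ is $d_H(A,B)=\max\{\sup_{a\in A}\inf_{b\in B}d(a,b),\ \sup_{b\in B}\inf_{a\in A}d(a,b)\}$; $\bar{\mathbf{B}}_X$ is equipped with the metric $d_H$. A metric space $Y$ is discrete if every point of $Y$ is isolated, i.e. for every $y\in Y$ there is $r>0$ such that the closed ball of radius $r$ centered at $y$ equals $\{y\}$. *)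

theory Defs
  imports "HOL-Analysis.Abstract_Metric_Spaces"
begin

locale ultrametric_space = Metric_space +
  assumes nonempty: "M \<noteq> {}"
    and ultrametric: "\<lbrakk>x \<in> M; y \<in> M; z \<in> M\<rbrakk> \<Longrightarrow> d x y \<le> max (d x z) (d z y)"

context Metric_space
begin

definition mdiscrete :: bool
  where "mdiscrete \<longleftrightarrow> (\<forall>y\<in>M. \<exists>r>0. mcball y r = {y})"

text \<open>Balls are plain subsets of \<open>M\<close>: different centres or radii may give the same element.\<close>

definition closed_balls :: "'a set set"
  where "closed_balls = {mcball c r | c r. c \<in> M \<and> 0 \<le> r}"

definition nonempty_closed_bounded :: "'a set set"
  where "nonempty_closed_bounded = {A. A \<noteq> {} \<and> closedin mtopology A \<and> mbounded A}"

text \<open>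
  The value 0 outside the nonempty closed bounded sets is a dummy: the locale
  \<^locale>\<open>Metric_space\<close> asks for nonnegativity and symmetry on the whole type.
\<close>

definition hausdorff_distance :: "'a set \<Rightarrow> 'a set \<Rightarrow> real"
  where "hausdorff_distance A B =
    (if A \<in> nonempty_closed_bounded \<and> B \<in> nonempty_closed_bounded
     then max (SUP a\<in>A. INF b\<in>B. d a b) (SUP b\<in>B. INF a\<in>A. d a b)
     else 0)"

lemma closed_balls_subset: "closed_balls \<subseteq> nonempty_closed_bounded"
  unfolding closed_balls_def nonempty_closed_bounded_def mbounded_def
  by (auto simp only: mcball_eq_empty closedin_mcball intro: subset_refl)

lemma ncb_subset: "A \<in> nonempty_closed_bounded \<Longrightarrow> A \<subseteq> M"
  by (auto simp: nonempty_closed_bounded_def dest: mbounded_subset_mspace)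

lemma INF_dist_le:
  assumes "b \<in> B"
  shows "(INF b\<in>B. d a b) \<le> d a b"
  by (rule cINF_lower[OF _ assms]) (auto intro: bdd_belowI[where m = 0])

lemma bdd_above_INF_dist:
  assumes A: "A \<in> nonempty_closed_bounded" and B: "B \<in> nonempty_closed_bounded"
  shows "bdd_above ((\<lambda>a. INF b\<in>B. d a b) ` A)"
proof -
  obtain x K where K: "A \<subseteq> mcball x K"
    using A by (auto simp: nonempty_closed_bounded_def mbounded_def)
  obtain b where b: "b \<in> B" "b \<in> M"
    using B ncb_subset[OF B] by (auto simp: nonempty_closed_bounded_def)
  have "(INF b\<in>B. d a b) \<le> K + d x b" if "a \<in> A" for a
  proof -
    have a: "a \<in> M" "x \<in> M" "d x a \<le> K" using K that by auto
    have "(INF b\<in>B. d a b) \<le> d a b" by (rule INF_dist_le[OF b(1)])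
    also have "\<dots> \<le> d x a + d x b" using triangle[of a x b] a b commute[of a x] by simp
    finally show ?thesis using a by simp
  qed
  then show ?thesis by (auto intro!: bdd_aboveI2)
qed

lemma INF_dist_le_SUP:
  assumes "A \<in> nonempty_closed_bounded" "B \<in> nonempty_closed_bounded" "a \<in> A"
  shows "(INF b\<in>B. d a b) \<le> (SUP a\<in>A. INF b\<in>B. d a b)"
  using bdd_above_INF_dist[OF assms(1,2)] assms(3) by (rule cSUP_upper2) simp

lemma INF_dist_nonneg:
  assumes "B \<in> nonempty_closed_bounded"
  shows "0 \<le> (INF b\<in>B. d a b)"
  using assms by (intro cINF_greatest) (auto simp: nonempty_closed_bounded_def)

lemma SUP_INF_dist_nonneg:
  assumes A: "A \<in> nonempty_closed_bounded" and B: "B \<in> nonempty_closed_bounded"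
  shows "0 \<le> (SUP a\<in>A. INF b\<in>B. d a b)"
proof -
  obtain a where "a \<in> A" using A by (auto simp: nonempty_closed_bounded_def)
  then show ?thesis using INF_dist_le_SUP[OF A B] INF_dist_nonneg[OF B] order_trans by blast
qed

lemma SUP_INF_dist_triangle:
  assumes A: "A \<in> nonempty_closed_bounded" and B: "B \<in> nonempty_closed_bounded"
    and C: "C \<in> nonempty_closed_bounded"
  shows "(SUP a\<in>A. INF c\<in>C. d a c) \<le> (SUP a\<in>A. INF b\<in>B. d a b) + (SUP b\<in>B. INF c\<in>C. d b c)"
proof (rule cSUP_least)
  show "A \<noteq> {}" using A by (auto simp: nonempty_closed_bounded_def)
  fix a assume a: "a \<in> A"
  have ne: "B \<noteq> {}" "C \<noteq> {}" using B C by (auto simp: nonempty_closed_bounded_def)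
  have "(INF c\<in>C. d a c) - (SUP b\<in>B. INF c\<in>C. d b c) \<le> (INF b\<in>B. d a b)"
  proof (rule cINF_greatest[OF ne(1)])
    fix b assume b: "b \<in> B"
    have "(INF c\<in>C. d a c) - d a b \<le> (INF c\<in>C. d b c)"
    proof (rule cINF_greatest[OF ne(2)])
      fix c assume c: "c \<in> C"
      have "d a c \<le> d a b + d b c"
        using a b c ncb_subset[OF A] ncb_subset[OF B] ncb_subset[OF C] by (intro triangle) auto
      then show "(INF c\<in>C. d a c) - d a b \<le> d b c" using INF_dist_le[OF c, of a] by simp
    qed
    then show "(INF c\<in>C. d a c) - (SUP b\<in>B. INF c\<in>C. d b c) \<le> d a b"
      using INF_dist_le_SUP[OF B C b] by simp
  qed
  then show "(INF c\<in>C. d a c) \<le> (SUP a\<in>A. INF b\<in>B. d a b) + (SUP b\<in>B. INF c\<in>C. d b c)"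
    using INF_dist_le_SUP[OF A B a] by simp
qed

lemma SUP_INF_dist_0_subset:
  assumes A: "A \<in> nonempty_closed_bounded" and B: "B \<in> nonempty_closed_bounded"
    and "(SUP a\<in>A. INF b\<in>B. d a b) \<le> 0"
  shows "A \<subseteq> B"
proof
  fix a assume a: "a \<in> A"
  show "a \<in> B"
  proof (rule ccontr)
    assume "a \<notin> B"
    moreover have "a \<in> M" "closedin mtopology B"
      using B a ncb_subset[OF A] by (auto simp: nonempty_closed_bounded_def)
    ultimately obtain r where r: "r > 0" "disjnt B (mball a r)"
      unfolding closedin_metric by blast
    have "r \<le> (INF b\<in>B. d a b)"
    proof (rule cINF_greatest)
      show "B \<noteq> {}" using B by (auto simp: nonempty_closed_bounded_def)
      show "r \<le> d a b" if "b \<in> B" for b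
        using that r a ncb_subset[OF A] ncb_subset[OF B] by (force simp: disjnt_iff)
    qed
    then show False using INF_dist_le_SUP[OF A B a] r assms(3) by simp
  qed
qed

lemma SUP_INF_dist_self:
  assumes A: "A \<in> nonempty_closed_bounded"
  shows "(SUP a\<in>A. INF b\<in>A. d a b) \<le> 0"
proof (rule cSUP_least)
  show "A \<noteq> {}" using A by (auto simp: nonempty_closed_bounded_def)
  show "(INF b\<in>A. d a b) \<le> 0" if "a \<in> A" for a
    using INF_dist_le[OF that, of a] that ncb_subset[OF A] by (simp add: subset_iff)
qed

lemma hausdorff_distance_eq:
  assumes "A \<in> nonempty_closed_bounded" "B \<in> nonempty_closed_bounded"
  shows "hausdorff_distance A B = max (SUP a\<in>A. INF b\<in>B. d a b) (SUP b\<in>B. INF a\<in>A. d b a)"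
  using assms unfolding hausdorff_distance_def by (simp add: commute)

lemma Metric_space_hausdorff: "Metric_space nonempty_closed_bounded hausdorff_distance"
proof
  show "0 \<le> hausdorff_distance A B" for A B
    using SUP_INF_dist_nonneg[of A B] by (auto simp: hausdorff_distance_def le_max_iff_disj)
  show "hausdorff_distance A B = hausdorff_distance B A" for A B
  proof (cases "A \<in> nonempty_closed_bounded \<and> B \<in> nonempty_closed_bounded")
    case True
    then show ?thesis using hausdorff_distance_eq[of A B] hausdorff_distance_eq[of B A] by linarith
  qed (auto simp: hausdorff_distance_def)
  show "hausdorff_distance A B = 0 \<longleftrightarrow> A = B"
    if A: "A \<in> nonempty_closed_bounded" and B: "B \<in> nonempty_closed_bounded" for A B
  proof
    assume "hausdorff_distance A B = 0"
    then have "(SUP a\<in>A. INF b\<in>B. d a b) \<le> 0" "(SUP b\<in>B. INF a\<in>A. d b a) \<le> 0"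
      using hausdorff_distance_eq[OF A B] by linarith+
    then show "A = B" using SUP_INF_dist_0_subset A B by blast
  next
    assume eq: "A = B"
    show "hausdorff_distance A B = 0"
      using hausdorff_distance_eq[OF A A] SUP_INF_dist_self[OF A] SUP_INF_dist_nonneg[OF A A]
      unfolding eq by linarith
  qed
  show "hausdorff_distance A C \<le> hausdorff_distance A B + hausdorff_distance B C"
    if A: "A \<in> nonempty_closed_bounded" and B: "B \<in> nonempty_closed_bounded"
      and C: "C \<in> nonempty_closed_bounded" for A B C
    using SUP_INF_dist_triangle[OF A B C] SUP_INF_dist_triangle[OF C B A]
      hausdorff_distance_eq[OF A B] hausdorff_distance_eq[OF B C] hausdorff_distance_eq[OF A C]
    by linarith
qed

lemma Metric_space_closed_balls: "Metric_space closed_balls hausdorff_distance"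
  using Metric_space.subspace[OF Metric_space_hausdorff closed_balls_subset] .

end

end

theory Submission
  imports Defs
begin

text \<open>
  The map sending \<open>x\<close> to the ball \<open>{x}\<close> is an isometric embedding, so discreteness passes from the
  space of balls to the space. Conversely, a ball containing two points at distance \<open>s > 0\<close> is
  isolated in every ultrametric space: a ball at Hausdorff distance less than \<open>s\<close> from it also
  contains two points at distance at least \<open>s\<close>, so both balls have radius at least \<open>s\<close> and each
  absorbs the other. Only singletons use the discreteness of the space.
\<close>

context Metric_space
begin

lemma singleton_closed_ball:
  assumes "x \<in> M"
  shows "{x} \<in> closed_balls"
proof -
  have "mcball x 0 = {x}" using assms by (auto simp del: mdist_pos_eq) (metis mdist_pos_less linorder_not_le)
  then show ?thesis using assms by (force simp: closed_balls_def)
qed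

lemma closed_ball_nonempty: "A \<in> closed_balls \<Longrightarrow> A \<noteq> {}"
  using closed_balls_subset by (auto simp: nonempty_closed_bounded_def)

lemma closed_ball_subset_mspace: "A \<in> closed_balls \<Longrightarrow> A \<subseteq> M"
  by (auto simp: closed_balls_def)

lemma hausdorff_distance_commute: "hausdorff_distance A B = hausdorff_distance B A"
  by (rule Metric_space.commute[OF Metric_space_hausdorff])

lemma hausdorff_distance_singletons:
  assumes "x \<in> M" "y \<in> M"
  shows "hausdorff_distance {x} {y} = d x y"
proof -
  have "{x} \<in> nonempty_closed_bounded" "{y} \<in> nonempty_closed_bounded"
    using assms singleton_closed_ball closed_balls_subset by blast+
  then show ?thesis by (simp add: hausdorff_distance_def)
qed

text \<open>The strict bound passes to the infimum of \<open>d a b\<close> over \<open>B\<close>,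
  which need not be attained; strictness still yields a witness.\<close>

lemma hausdorff_distance_lessD:
  assumes A: "A \<in> closed_balls" and B: "B \<in> closed_balls"
    and less: "hausdorff_distance A B < s" and a: "a \<in> A"
  obtains b where "b \<in> B" "d a b < s"
proof -
  have AB: "A \<in> nonempty_closed_bounded" "B \<in> nonempty_closed_bounded"
    using A B closed_balls_subset by blast+
  have "(INF b\<in>B. d a b) < s"
    using INF_dist_le_SUP[OF AB a] hausdorff_distance_eq[OF AB] less by linarith
  moreover have "bdd_below (d a ` B)"
    by (auto intro: bdd_belowI[where m = 0])
  ultimately show thesis
    using that closed_ball_nonempty[OF B] by (auto simp: cINF_less_iff)
qed

end

context ultrametric_space
begin

text \<open>A ball, as a set, does not determine its radius, so the distance of two of its points
  serves as a lower bound for any radius \<open>r\<close> representing it. The strong triangle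
  inequality through the centre then puts \<open>w\<close> within \<open>r\<close> as well.\<close>

lemma closed_ball_absorb:
  assumes A: "A \<in> closed_balls" and "x \<in> A" "y \<in> A" "z \<in> A" "w \<in> M" and le: "d z w \<le> d x y"
  shows "w \<in> A"
proof -
  obtain c r where c: "A = mcball c r" "c \<in> M"
    using A by (auto simp: closed_balls_def)
  then have *: "x \<in> M" "y \<in> M" "z \<in> M" "d x c \<le> r" "d c y \<le> r" "d c z \<le> r"
    using assms commute by auto
  have "d x y \<le> r" using ultrametric[of x y c] * c by auto
  then have "d c w \<le> r" using ultrametric[of c w z] * c le \<open>w \<in> M\<close> by auto
  then show ?thesis using c \<open>w \<in> M\<close> by auto
qed

text \<open>Each point of \<open>A\<close> is closer than \<open>s\<close> to some point of
  \<open>B\<close>, and \<open>B\<close> absorbs everything that close because it already contains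
  two points \<open>s\<close> apart.\<close>

lemma closed_ball_subset_if_near:
  assumes A: "A \<in> closed_balls" and B: "B \<in> closed_balls"
    and less: "hausdorff_distance A B < s"
    and xy: "x \<in> B" "y \<in> B" "s \<le> d x y"
  shows "A \<subseteq> B"
proof
  fix a assume a: "a \<in> A"
  then obtain b where "b \<in> B" "d a b < s"
    using hausdorff_distance_lessD[OF A B less] by blast
  then show "a \<in> B"
    using closed_ball_absorb[OF B xy(1,2), of b a] xy(3) a closed_ball_subset_mspace[OF A] commute[of a b]
    by auto
qed

lemma closed_ball_eq_if_near:
  assumes A: "A \<in> closed_balls" and B: "B \<in> closed_balls"
    and xy: "x \<in> A" "y \<in> A" and less: "hausdorff_distance A B < d x y"
  shows "A = B"
proof -
  obtain u where u: "u \<in> B" "d x u < d x y"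
    using hausdorff_distance_lessD[OF A B less xy(1)] .
  obtain v where v: "v \<in> B" "d y v < d x y"
    using hausdorff_distance_lessD[OF A B less xy(2)] .
  have M: "x \<in> M" "y \<in> M" "u \<in> M" "v \<in> M"
    using closed_ball_subset_mspace A B xy u v by blast+
  \<comment> \<open>Along the chain \<open>x\<close>, \<open>u\<close>, \<open>v\<close>,
    \<open>y\<close> the largest step is at least \<open>d x y\<close>; the two outer steps are too
    short, so the middle one must be.\<close>
  have "d x y \<le> d u v"
    using ultrametric[of x y u] ultrametric[of u y v] M u v commute[of v y] by auto
  then have "A \<subseteq> B" using closed_ball_subset_if_near[OF A B less u(1) v(1)] by blast
  moreover have "B \<subseteq> A"
    using closed_ball_subset_if_near[OF B A _ xy order_refl] less hausdorff_distance_commute by simp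
  ultimately show ?thesis by blast
qed

lemma mdiscrete_iff_closed_balls:
  "mdiscrete \<longleftrightarrow> Metric_space.mdiscrete closed_balls hausdorff_distance"
proof -
  interpret H: Metric_space closed_balls hausdorff_distance
    by (rule Metric_space_closed_balls)
  show ?thesis
  proof
    assume disc: "mdiscrete"
    show "H.mdiscrete"
      unfolding H.mdiscrete_def
    proof
      fix A assume A: "A \<in> closed_balls"
      have "\<exists>s>0. \<forall>B\<in>closed_balls. hausdorff_distance A B < s \<longrightarrow> A = B"
      proof (cases "\<exists>x\<in>A. \<exists>y\<in>A. x \<noteq> y")
        case True
        then obtain x y where xy: "x \<in> A" "y \<in> A" "x \<noteq> y" by blast
        then have "d x y > 0" using closed_ball_subset_mspace[OF A] mdist_pos_less by blast
        then show ?thesis using closed_ball_eq_if_near[OF A _ xy(1,2)] by blast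
      next
        case False
        obtain c where "c \<in> A" using closed_ball_nonempty[OF A] by blast
        then have c: "A = {c}" "c \<in> M"
          using False closed_ball_subset_mspace[OF A] by blast+
        obtain r where r: "r > 0" "mcball c r = {c}"
          using c disc by (auto simp: mdiscrete_def)
        have "A = B" if B: "B \<in> closed_balls" and less: "hausdorff_distance A B < r" for B
        proof -
          have "b = c" if b: "b \<in> B" for b
          proof -
            \<comment> \<open>Some point of \<open>A\<close> lies within \<open>r\<close> of
              \<open>b\<close>, and \<open>c\<close> is the only candidate.\<close>
            have "d b c < r"
              using hausdorff_distance_lessD[OF B A _ b] less c
              by (metis hausdorff_distance_commute singletonD)
            then have "b \<in> mcball c r"
              using b c closed_ball_subset_mspace[OF B] commute[of b c] by auto
            then show ?thesis using r by simp
          qed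
          then show ?thesis using closed_ball_nonempty[OF B] c by auto
        qed
        then show ?thesis using r by blast
      qed
      then obtain s where "s > 0" "\<forall>B\<in>closed_balls. hausdorff_distance A B < s \<longrightarrow> A = B"
        by blast
      \<comment> \<open>\<open>s\<close> isolates \<open>A\<close> under a strict inequality,
        whereas \<open>mdiscrete\<close> asks for a closed ball; halving bridges the two.\<close>
      then have "H.mcball A (s / 2) = {A}" "s / 2 > 0" using A by fastforce+
      then show "\<exists>r>0. H.mcball A r = {A}" by blast
    qed
  next
    assume disc: "H.mdiscrete"
    show "mdiscrete"
      unfolding mdiscrete_def
    proof
      fix c assume c: "c \<in> M"
      then obtain r where r: "r > 0" "H.mcball {c} r = {{c}}"
        using disc singleton_closed_ball unfolding H.mdiscrete_def by meson
      have "y = c" if "y \<in> mcball c r" for y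
      proof -
        have "{y} \<in> H.mcball {c} r"
          using that c singleton_closed_ball hausdorff_distance_singletons by auto
        then show ?thesis using r by simp
      qed
      then have "mcball c r = {c}" using c r by auto
      then show "\<exists>r>0. mcball c r = {c}" using r by blast
    qed
  qed
qed

end

theorem theorem5p1:
  fixes X :: "'a set" and d :: "'a \<Rightarrow> 'a \<Rightarrow> real"
  assumes "ultrametric_space X d"
  shows "Metric_space.mdiscrete X d \<longleftrightarrow>
    Metric_space.mdiscrete (Metric_space.closed_balls X d) (Metric_space.hausdorff_distance X d)"
  using ultrametric_space.mdiscrete_iff_closed_balls[OF assms] .

end
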